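(* Let $e\ge 1$ be an integer, let $g\in\mathbb{Z}$ be odd, and let $c\in\mathbb{Z}$ be fixed. Then there is exactly $1$ solution $x\in\{1,2,\ldots,2^e\}$ to the congruence $$g^{x-1+c}\equiv x\pmod{2^e}.$$
   Context: Powers of $g$ with negative exponents are understood in the unit group $(\mathbb{Z}/2^e\mathbb{Z})^\times$. *)

theory Defs
  imports "HOL-Number_Theory.Number_Theory"
begin

text \<open>
  The multiplicative group of units of the integers modulo \<open>m\<close>, on the representatives
  \<open>0, \<dots>, m - 1\<close>. Integer powers in it are the library's group powers \<open>[^]\<close>.
\<close>

abbreviation unit_group_mod :: "int \<Rightarrow> int monoid"
  where "unit_group_mod m \<equiv> units_of (residue_ring m)"

text \<open>
  The class of an integer coprime to the modulus lies in the group, and its powers with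
  nonnegative exponent are the ordinary ones.
\<close>

lemma mod_in_unit_group_mod:
  fixes g m :: int
  assumes "m > 1" and "coprime g m"
  shows "g mod m \<in> carrier (unit_group_mod m)"
proof -
  interpret residues m "residue_ring m"
    using assms(1) by unfold_locales simp_all
  show ?thesis
    using assms mod_in_res_units by (simp add: units_of_carrier)
qed

lemma unit_group_mod_pow_nat:
  fixes g m :: int and n :: nat
  assumes "m > 1"
  shows "[(g mod m) [^]\<^bsub>unit_group_mod m\<^esub> int n = g ^ n] (mod m)"
proof (induction n)
  case 0
  show ?case
    by (simp add: int_pow_def2 units_of_def residue_ring_def)
next
  case (Suc n)
  let ?p = "(g mod m) [^]\<^bsub>unit_group_mod m\<^esub> n"
  have "(g mod m) [^]\<^bsub>unit_group_mod m\<^esub> int (Suc n) = (?p * (g mod m)) mod m"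
    by (simp only: int_pow_int nat_pow_Suc) (simp add: units_of_def residue_ring_def)
  moreover have "[?p * (g mod m) = g ^ n * g] (mod m)"
    using Suc.IH by (intro cong_mult) (simp_all add: int_pow_int)
  ultimately show ?case
    by (simp add: cong_def mult.commute)
qed

end

theory Submission
  imports Defs
begin

text \<open>
  For odd \<open>g\<close> the power \<open>g ^ n\<close> modulo \<open>2 ^ (e + 1)\<close> depends only on \<open>n\<close> modulo \<open>2 ^ e\<close>. Hence a
  solution \<open>x\<close> modulo \<open>2 ^ e\<close> of the congruence \<open>g ^ (x + d) \<equiv> x\<close> lifts uniquely to modulus
  \<open>2 ^ (e + 1)\<close>: the left-hand side is already determined there, and it is the lift. Integer
  exponents are reduced to natural ones by the same periodicity.
\<close>

text \<open>Squaring gains one factor of 2: in \<open>a^2 - 1 = (a + 1) * (a - 1)\<close> with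
  \<open>a = g ^ 2 ^ e\<close>, the first factor is even and the second is divisible by
  \<open>2 ^ Suc e\<close>.\<close>

lemma odd_power_two_power_cong_1:
  fixes g :: int
  assumes "odd g"
  shows "[g ^ (2 ^ e) = 1] (mod 2 ^ Suc e)"
proof (induction e)
  case 0
  show ?case
    using assms by (simp add: cong_iff_dvd_diff)
next
  case (Suc e)
  have "2 * 2 ^ Suc e dvd (g ^ 2 ^ e + 1) * (g ^ 2 ^ e - 1)"
    using Suc.IH assms by (intro mult_dvd_mono) (simp_all add: cong_iff_dvd_diff)
  also have "(g ^ 2 ^ e + 1) * (g ^ 2 ^ e - 1) = (g ^ 2 ^ e)\<^sup>2 - 1"
    by (simp add: power2_eq_square algebra_simps)
  also have "(g ^ 2 ^ e)\<^sup>2 = g ^ 2 ^ Suc e"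
    by (simp only: power_Suc2 flip: power_mult)
  finally show ?case
    by (simp add: cong_iff_dvd_diff)
qed

lemma odd_power_cong_two_power:
  fixes g :: int
  assumes "odd g" and "[m = n] (mod 2 ^ e)"
  shows "[g ^ m = g ^ n] (mod 2 ^ Suc e)"
proof -
  have red: "[g ^ k = g ^ (k mod 2 ^ e)] (mod 2 ^ Suc e)" for k
  proof -
    have "g ^ k = (g ^ 2 ^ e) ^ (k div 2 ^ e) * g ^ (k mod 2 ^ e)"
      by (simp only: mult_div_mod_eq flip: power_mult power_add)
    also have "[\<dots> = 1 ^ (k div 2 ^ e) * g ^ (k mod 2 ^ e)] (mod 2 ^ Suc e)"
      using assms(1) by (intro cong_mult cong_pow odd_power_two_power_cong_1 cong_refl)
    finally show ?thesis
      by simp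
  qed
  show ?thesis
    using red[of m] red[of n] assms(2) by (simp add: cong_def)
qed

lemma two_power_fixed_point_exists:
  fixes g :: int
  assumes "odd g"
  shows "\<exists>x::nat. [g ^ (x + d) = int x] (mod 2 ^ e)"
proof (induction e)
  case 0
  show ?case
    by simp
next
  case (Suc e)
  then obtain x where x: "[g ^ (x + d) = int x] (mod 2 ^ e)"
    by blast
  \<comment> \<open>The lift is the left-hand side at the old solution \<open>x\<close>. It agrees
    with \<open>x\<close> modulo \<open>2 ^ e\<close>, so putting it into the exponent leaves the
    power unchanged modulo \<open>2 ^ Suc e\<close>.\<close>
  define y where "y = nat (g ^ (x + d) mod 2 ^ Suc e)"
  have y: "[int y = g ^ (x + d)] (mod 2 ^ Suc e)"
    by (simp add: y_def)
  have "[int y = g ^ (x + d)] (mod 2 ^ e)"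
    using y by (rule cong_dvd_modulus) simp
  then have "[int y = int x] (mod 2 ^ e)"
    using x by (rule cong_trans)
  then have "[y = x] (mod 2 ^ e)"
    by (simp flip: cong_int_iff)
  then have "[g ^ (y + d) = g ^ (x + d)] (mod 2 ^ Suc e)"
    using assms by (intro odd_power_cong_two_power cong_add cong_refl)
  then show ?case
    using y cong_sym cong_trans by blast
qed

text \<open>Solutions modulo \<open>2 ^ Suc e\<close> also solve the congruence modulo
  \<open>2 ^ e\<close>, so by induction they agree there. Their powers then agree modulo
  \<open>2 ^ Suc e\<close>, and hence so do they.\<close>

lemma two_power_fixed_point_unique:
  fixes g :: int and x y :: nat
  assumes "odd g"
    and "[g ^ (x + d) = int x] (mod 2 ^ e)" and "[g ^ (y + d) = int y] (mod 2 ^ e)"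
  shows "[x = y] (mod 2 ^ e)"
  using assms(2,3)
proof (induction e)
  case 0
  show ?case
    by simp
next
  case (Suc e)
  have "[g ^ (x + d) = int x] (mod 2 ^ e)" "[g ^ (y + d) = int y] (mod 2 ^ e)"
    using Suc.prems by (auto elim: cong_dvd_modulus)
  then have "[x = y] (mod 2 ^ e)"
    by (rule Suc.IH)
  then have "[g ^ (x + d) = g ^ (y + d)] (mod 2 ^ Suc e)"
    using assms(1) by (intro odd_power_cong_two_power cong_add cong_refl)
  then have "[int x = int y] (mod 2 ^ Suc e)"
    using Suc.prems cong_sym cong_trans by blast
  then show ?case
    by (simp flip: cong_int_iff)
qed

text \<open>Passes from group powers with any integer exponent to ordinary powers: the
  \<open>2 ^ e\<close>-th power of the class of \<open>g\<close> is the identity.\<close>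

lemma unit_group_mod_two_power_pow_cong:
  fixes g k :: int and n :: nat
  assumes "e \<ge> 1" and "odd g" and "[k = int n] (mod 2 ^ e)"
  shows "[(g mod 2 ^ e) [^]\<^bsub>unit_group_mod (2 ^ e)\<^esub> k = g ^ n] (mod 2 ^ e)"
proof -
  define m :: int where "m = 2 ^ e"
  have m: "m > 1"
    using assms(1) by (simp add: m_def)
  interpret residues m "residue_ring m"
    using m by unfold_locales simp_all
  let ?G = "unit_group_mod m"
  interpret G: group ?G
    by (rule units_group)
  have a: "g mod m \<in> carrier ?G"
    using m assms(2) by (intro mod_in_unit_group_mod) (simp_all add: m_def)
  obtain t where t: "k = int n + m * t"
    using assms(3) by (metis cong_iff_lin cong_sym m_def)
  \<comment> \<open>Group elements are reduced representatives, so a congruence to 1 becomes an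
    equality with the identity.\<close>
  have range: "x mod m = x" if "x \<in> carrier ?G" for x
    using that by (auto simp: units_of_carrier res_units_eq)
  have "[g ^ 2 ^ e = 1] (mod m)"
    unfolding m_def using odd_power_two_power_cong_1[OF assms(2)]
    by (rule cong_dvd_modulus) simp
  then have "[(g mod m) [^]\<^bsub>?G\<^esub> m = 1] (mod m)"
    using unit_group_mod_pow_nat[OF m, of g "2 ^ e"] cong_trans by (auto simp: m_def)
  then have "(g mod m) [^]\<^bsub>?G\<^esub> m = \<one>\<^bsub>?G\<^esub>"
    using range[OF G.int_pow_closed[OF a, of m]] m
    by (simp add: cong_def units_of_one one_cong)
  then have "(g mod m) [^]\<^bsub>?G\<^esub> (m * t) = \<one>\<^bsub>?G\<^esub>"
    using G.int_pow_pow[OF a, of m t] by (simp add: G.int_pow_one)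
  then have "(g mod m) [^]\<^bsub>?G\<^esub> k = (g mod m) [^]\<^bsub>?G\<^esub> int n"
    using a G.int_pow_closed[OF a] by (simp only: t G.int_pow_mult G.r_one)
  then show ?thesis
    using unit_group_mod_pow_nat[OF m, of g n] by (simp add: m_def)
qed

theorem corollary29:
  fixes e :: nat and g c :: int
  assumes "e \<ge> 1" and "odd g"
  shows "\<exists>!x::int. x \<in> {1..2 ^ e} \<and>
           [(g mod 2 ^ e) [^]\<^bsub>unit_group_mod (2 ^ e)\<^esub> (x - 1 + c) = x] (mod 2 ^ e)"
proof -
  \<comment> \<open>A natural representative of \<open>c - 1\<close>, which turns the exponent
    \<open>x - 1 + c\<close> into \<open>x + d\<close>.\<close>
  define d where "d = nat ((c - 1) mod 2 ^ e)"
  have d: "[c - 1 = int d] (mod 2 ^ e)"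
    by (simp add: d_def)
  have key: "[(g mod 2 ^ e) [^]\<^bsub>unit_group_mod (2 ^ e)\<^esub> (x - 1 + c) = x] (mod 2 ^ e)
      \<longleftrightarrow> [g ^ (n + d) = int n] (mod 2 ^ e)" if "[x = int n] (mod 2 ^ e)" for x n
  proof -
    have "[x - 1 + c = int (n + d)] (mod 2 ^ e)"
      using cong_add[OF that d] by (simp add: algebra_simps)
    from unit_group_mod_two_power_pow_cong[OF assms this] that show ?thesis
      by (simp add: cong_def)
  qed
  show ?thesis
  proof (rule ex_ex1I)
    obtain n where n: "[g ^ (n + d) = int n] (mod 2 ^ e)"
      using two_power_fixed_point_exists[OF assms(2)] by blast
    \<comment> \<open>The shift by one selects representatives in \<open>{1..2 ^ e}\<close>, with
      \<open>2 ^ e\<close> standing for the class of 0.\<close>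
    define x where "x = (int n - 1) mod 2 ^ e + 1"
    have "[x = int n] (mod 2 ^ e)"
      by (simp add: x_def cong_def mod_add_left_eq)
    moreover have "x \<in> {1..2 ^ e}"
      using pos_mod_bound[of "2 ^ e" "int n - 1"] by (simp add: x_def zless_imp_add1_zle)
    ultimately show "\<exists>x. x \<in> {1..2 ^ e} \<and>
        [(g mod 2 ^ e) [^]\<^bsub>unit_group_mod (2 ^ e)\<^esub> (x - 1 + c) = x] (mod 2 ^ e)"
      using key n by blast
  next
    fix x y :: int
    assume x: "x \<in> {1..2 ^ e} \<and>
        [(g mod 2 ^ e) [^]\<^bsub>unit_group_mod (2 ^ e)\<^esub> (x - 1 + c) = x] (mod 2 ^ e)"
      and y: "y \<in> {1..2 ^ e} \<and>
        [(g mod 2 ^ e) [^]\<^bsub>unit_group_mod (2 ^ e)\<^esub> (y - 1 + c) = y] (mod 2 ^ e)"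
    have "[g ^ (nat x + d) = int (nat x)] (mod 2 ^ e)" "[g ^ (nat y + d) = int (nat y)] (mod 2 ^ e)"
      using x y key[of x "nat x"] key[of y "nat y"] by simp_all
    from two_power_fixed_point_unique[OF assms(2) this]
    have "[int (nat x) = int (nat y)] (mod 2 ^ e)"
      by (simp flip: cong_int_iff)
    \<comment> \<open>Both differences lie in \<open>{0..<2 ^ e}\<close>, where congruence is
      equality.\<close>
    then have "[x - 1 = y - 1] (mod 2 ^ e)"
      using x y by (intro cong_diff) simp_all
    then show "x = y"
      using x y by (simp add: cong_def)
  qed
qed

end
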